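(* Let $(Y_i,X_i)_{i\ge1}$ be i.i.d. copies of $(Y,X)$, where $X$ has support $[0,1]$, $Y=m(X)+\varepsilon$, $\mathbb{E}[\varepsilon|X]=0$, and $m(x)=\mathbb{E}[Y|X=x]$ is non-decreasing on $[0,1]$. Suppose that the conditional distribution of $\varepsilon$ given $X=0$ is not degenerate and that $x\mapsto\Pr(Y\le y|X=x)$ is continuous for every $y$. Let $\hat m$ be the isotonic regression estimator based on $(Y_i,X_i)_{i=1}^n$ and $X_{(1)}=\min_{1\le i\le n}X_i$. Then there exists $\epsilon>0$ such that $$\liminf_{n\to\infty}\Pr\left(|\hat m(X_{(1)})-m(0)|>\epsilon\right)>0.$$
   Context: The isotonic regression estimator $\hat m$ minimizes $\sum_{i=1}^n(Y_i-\phi(X_i))^2$ over all non-decreasing $\phi:[0,1]\to\mathbb{R}$; it is uniquely determined at the data points. The covariates are assumed to be almost surely distinct, with ordered values $X_{(1)}<\dots<X_{(n)}$. At the first order statistic, $\hat m(X_{(1)})=\min_{1\le i\le n}\frac1i\sum_{j=1}^iY_{(j)}$, where $Y_{(j)}$ is the outcome corresponding to $X_{(j)}$. The value at the boundary is $m(0)=\mathbb{E}[Y|X=0]=\lim_{x\downarrow0}m(x)$. *)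

theory Defs
  imports "HOL-Probability.Probability"
begin

definition topological_support :: "'a::topological_space measure \<Rightarrow> 'a set" where
  "topological_support \<mu> = {x. \<forall>U. open U \<and> x \<in> U \<longrightarrow> emeasure \<mu> U > 0}"

text \<open>
  A regular conditional distribution of \<open>Y\<close> given \<open>X\<close>: \<open>K x\<close> is a version of the law of \<open>Y\<close>
  given \<open>X = x\<close>. A kernel with this property is determined only up to a null set of points \<open>x\<close>.
  Statements at a single point \<open>x\<close> become meaningful when \<open>K\<close> is moreover required to be
  continuous in \<open>x\<close> on the support of \<open>X\<close>, since at most one version is continuous there.
\<close>
definition regular_cond_distr ::
    "'a measure \<Rightarrow> ('a \<Rightarrow> real) \<Rightarrow> ('a \<Rightarrow> real) \<Rightarrow> (real \<Rightarrow> real measure) \<Rightarrow> bool" where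
  "regular_cond_distr M Y X K \<longleftrightarrow>
     K \<in> borel \<rightarrow>\<^sub>M prob_algebra borel \<and>
     (\<forall>A\<in>sets borel. \<forall>B\<in>sets borel.
        emeasure M {\<omega> \<in> space M. X \<omega> \<in> A \<and> Y \<omega> \<in> B} =
        (\<integral>\<^sup>+x\<in>A. emeasure (K x) B \<partial>distr M borel X))"

text \<open>
  Functions from \<open>[0,1]\<close> to the reals are represented by extensional functions, which have a
  fixed value outside \<open>[0,1]\<close>; data points outside \<open>[0,1]\<close> thus do not affect the minimization.
\<close>
definition isotonic_functions :: "(real \<Rightarrow> real) set" where
  "isotonic_functions = {\<phi> \<in> extensional {0..1}. mono_on {0..1} \<phi>}"

text \<open>
  Minimizers are unique at the data points in \<open>[0,1]\<close>, but not between them, hence a predicate.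
\<close>
definition isotonic_regression ::
    "nat \<Rightarrow> (nat \<Rightarrow> real) \<Rightarrow> (nat \<Rightarrow> real) \<Rightarrow> (real \<Rightarrow> real) \<Rightarrow> bool" where
  "isotonic_regression n y x =
     is_arg_min (\<lambda>\<phi>. \<Sum>i<n. (y i - \<phi> (x i))\<^sup>2) (\<lambda>\<phi>. \<phi> \<in> isotonic_functions)"

end

theory Submission
  imports Defs
begin

text \<open>
  The fit at the smallest design point averages over too few observations to be consistent:
  lowering the fit at that point alone keeps it isotonic, so the least-squares value there never
  exceeds the single response \<open>Y\<^sub>(\<^sub>1\<^sub>)\<close> observed there
  (\<open>isotonic_regression_le_first_response\<close>). The law of this response is a mixture
  of the kernels \<open>K x\<close> at points \<open>x\<close> near \<open>0\<close>. As \<open>K 0\<close> is not degenerate, it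
  charges \<open>{..y\<^sub>0}\<close> for some \<open>y\<^sub>0 < m 0\<close> (\<open>prob_below_mean_pos\<close>), and continuity of the kernel
  provides \<open>c, \<delta> > 0\<close> with \<open>K x {..y\<^sub>0} \<ge> c\<close> for all \<open>x \<in> {0..\<delta>}\<close>.

  Conditioning on which observation is the leftmost one does not distort the law of its response:
  the event that observation \<open>i\<close> is the strict leftmost one involves this observation only
  through \<open>X\<^sub>i\<close>, so for fixed covariates of the other observations it restricts \<open>X\<^sub>i\<close>
  to a Borel set
  (\<open>indep_var_prob_ge_of_sections\<close>, \<open>regular_cond_distr_prob_ge\<close>).
  Summing over \<open>i\<close> shows that for every \<open>n \<ge> 1\<close> the fit at the leftmost point is at most
  \<open>y\<^sub>0\<close> with probability at least \<open>c\<close> times the probability that the leftmost point lies in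
  \<open>{0..\<delta>}\<close>. The latter is at least the probability that \<open>X \<in> {0..\<delta>}\<close>, which is positive
  because \<open>0\<close> is in the support. So the lower bound holds uniformly in \<open>n\<close>.

  The measure of a set outside the \<open>\<sigma>\<close>-algebra is \<open>0\<close> by convention, so the argument also needs
  the deviation event to be measurable, although the minimizer is chosen separately for every
  sample point. Its value at the leftmost point is determined by the data, and its superlevel
  sets are described by the signs of finitely many partial sums
  (\<open>isotonic_regression_first_value_greater_iff\<close>).
\<close>

section \<open>First-order conditions for isotonic least squares\<close>

text \<open>
  The left-hand side is, up to the factor \<open>-2\<close>, the derivative of the sum of squares in the
  direction \<open>h\<close>. Only the values at the data points matter, so the admissible competitors may
  interpolate between the data points in any isotonic way.
\<close>
lemma isotonic_regression_directional_derivative: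
  fixes x y :: "nat \<Rightarrow> real" and h :: "nat \<Rightarrow> real"
  assumes reg: "isotonic_regression n y x \<phi>" and "s0 > 0"
    and dir: "\<And>s. 0 < s \<Longrightarrow> s < s0 \<Longrightarrow>
      \<exists>\<psi>\<in>isotonic_functions. \<forall>i<n. \<psi> (x i) = \<phi> (x i) + s * h i"
  shows "(\<Sum>i<n. (y i - \<phi> (x i)) * h i) \<le> 0"
proof (rule ccontr)
  define R where "R = (\<Sum>i<n. (y i - \<phi> (x i)) * h i)"
  define Q where "Q = (\<Sum>i<n. (h i)\<^sup>2)"
  assume "\<not> ?thesis"
  hence R: "R > 0" by (simp add: R_def)
  have Q: "Q \<ge> 0" by (simp add: Q_def sum_nonneg)
  define s where "s = min (s0 / 2) (R / (Q + 1))"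
  have s: "0 < s" "s < s0" using R Q \<open>s0 > 0\<close> by (auto simp: s_def min_less_iff_disj)
  obtain \<psi> where \<psi>: "\<psi> \<in> isotonic_functions" "\<And>i. i < n \<Longrightarrow> \<psi> (x i) = \<phi> (x i) + s * h i"
    using dir[OF s] by auto
  have "(\<Sum>i<n. (y i - \<phi> (x i))\<^sup>2) \<le> (\<Sum>i<n. (y i - \<psi> (x i))\<^sup>2)"
    using reg \<psi>(1) unfolding isotonic_regression_def is_arg_min_def by (auto simp: not_less)
  also have "\<dots> = (\<Sum>i<n. (y i - \<phi> (x i))\<^sup>2 - 2 * s * ((y i - \<phi> (x i)) * h i) + s\<^sup>2 * (h i)\<^sup>2)"
    by (rule sum.cong) (auto simp: \<psi>(2) power2_eq_square algebra_simps)
  also have "\<dots> = (\<Sum>i<n. (y i - \<phi> (x i))\<^sup>2) - 2 * s * R + s\<^sup>2 * Q"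
    by (simp add: sum.distrib sum_subtractf R_def Q_def sum_distrib_left)
  finally have "s * (2 * R) \<le> s * (s * Q)" by (simp add: power2_eq_square algebra_simps)
  hence "2 * R \<le> s * Q" using s by simp
  also have "\<dots> \<le> R / (Q + 1) * Q" using Q by (intro mult_right_mono) (auto simp: s_def)
  also have "\<dots> \<le> R" using Q R by (simp add: field_simps)
  finally show False using R by simp
qed

text \<open>
  Lowering the fit by a constant on an initial segment keeps it isotonic, so by minimality such
  a move cannot reduce the sum of squares.
\<close>
lemma isotonic_regression_initial_sum:
  assumes reg: "isotonic_regression n y x \<phi>"
  shows "(\<Sum>i | i < n \<and> x i \<in> {0..1} \<and> x i \<le> t. \<phi> (x i)) \<le>
         (\<Sum>i | i < n \<and> x i \<in> {0..1} \<and> x i \<le> t. y i)"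
proof -
  let ?h = "\<lambda>i. if x i \<in> {0..1} \<and> x i \<le> t then -1 else 0 :: real"
  have \<phi>: "\<phi> \<in> extensional {0..1}" "mono_on {0..1} \<phi>"
    using reg by (auto simp: isotonic_regression_def is_arg_min_def isotonic_functions_def)
  have "(\<Sum>i<n. (y i - \<phi> (x i)) * ?h i) \<le> 0"
  proof (rule isotonic_regression_directional_derivative[OF reg zero_less_one])
    fix s :: real assume s: "0 < s"
    let ?\<psi> = "\<lambda>u. if u \<in> {0..1} \<and> u \<le> t then \<phi> u - s else \<phi> u"
    have "mono_on {0..1} ?\<psi>"
    proof (rule mono_onI)
      fix u v :: real assume uv: "u \<in> {0..1}" "v \<in> {0..1}" "u \<le> v"
      show "?\<psi> u \<le> ?\<psi> v" using mono_onD[OF \<phi>(2) uv] uv s by simp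
    qed
    moreover have "?\<psi> \<in> extensional {0..1}" using \<phi>(1) by (simp add: extensional_def)
    ultimately have "?\<psi> \<in> isotonic_functions" by (simp add: isotonic_functions_def)
    thus "\<exists>\<psi>\<in>isotonic_functions. \<forall>i<n. \<psi> (x i) = \<phi> (x i) + s * ?h i"
      by (intro bexI[of _ ?\<psi>]) auto
  qed
  also have "(\<Sum>i<n. (y i - \<phi> (x i)) * ?h i) =
      (\<Sum>i<n. if x i \<in> {0..1} \<and> x i \<le> t then \<phi> (x i) - y i else 0)"
    by (rule sum.cong) auto
  also have "\<dots> = (\<Sum>i | i < n \<and> x i \<in> {0..1} \<and> x i \<le> t. \<phi> (x i) - y i)"
    by (subst sum.inter_filter[symmetric]) (auto intro: sum.cong)
  finally show ?thesis by (simp add: sum_subtractf)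
qed

text \<open>
  The lowest level set of the fit may be raised by a small amount. The competitor
  \<open>max \<phi> (v + s)\<close> does this: it is isotonic on the whole interval, and for small \<open>s\<close>
  it differs from \<open>\<phi>\<close> at the data points of the first block only.
\<close>
lemma isotonic_regression_first_block_sum:
  assumes reg: "isotonic_regression n y x \<phi>"
    and k: "k < n" "x k \<in> {0..1}"
    and least: "\<And>i. i < n \<Longrightarrow> x i \<in> {0..1} \<Longrightarrow> x k \<le> x i"
  shows "(\<Sum>i | i < n \<and> x i \<in> {0..1} \<and> \<phi> (x i) = \<phi> (x k). y i - \<phi> (x k)) \<le> 0"
proof -
  define v where "v = \<phi> (x k)"
  let ?h = "\<lambda>i. if x i \<in> {0..1} \<and> \<phi> (x i) = v then 1 else 0 :: real"
  have \<phi>: "\<phi> \<in> extensional {0..1}" "mono_on {0..1} \<phi>"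
    using reg by (auto simp: isotonic_regression_def is_arg_min_def isotonic_functions_def)
  have ge: "v \<le> \<phi> (x i)" if "i < n" "x i \<in> {0..1}" for i
    using mono_onD[OF \<phi>(2) k(2) that(2)] least that by (auto simp: v_def)
  \<comment> \<open>the next fitted value above the first block limits how far the block can be raised\<close>
  define s0 where "s0 = Min (insert 1 ((\<lambda>i. \<phi> (x i) - v) ` {i. i < n \<and> \<phi> (x i) > v}))"
  have s0: "s0 > 0" unfolding s0_def by (subst Min_gr_iff) auto
  have gap: "s0 \<le> \<phi> (x i) - v" if "i < n" "\<phi> (x i) > v" for i
    unfolding s0_def using that by (intro Min_le) auto
  have "(\<Sum>i<n. (y i - \<phi> (x i)) * ?h i) \<le> 0"
  proof (rule isotonic_regression_directional_derivative[OF reg s0])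
    fix s :: real assume s: "0 < s" "s < s0"
    let ?\<psi> = "\<lambda>u. if u \<in> {0..1} then max (\<phi> u) (v + s) else \<phi> u"
    have "?\<psi> \<in> isotonic_functions"
      using \<phi> unfolding isotonic_functions_def
      by (auto simp: extensional_def mono_on_def intro: max.coboundedI1)
    moreover have "?\<psi> (x i) = \<phi> (x i) + s * ?h i" if i: "i < n" for i
      using ge[OF i] gap[OF i] s by (cases "\<phi> (x i) = v") (auto simp: max_def)
    ultimately show "\<exists>\<psi>\<in>isotonic_functions. \<forall>i<n. \<psi> (x i) = \<phi> (x i) + s * ?h i"
      by (intro bexI[of _ ?\<psi>]) auto
  qed
  also have "(\<Sum>i<n. (y i - \<phi> (x i)) * ?h i) =
      (\<Sum>i<n. if x i \<in> {0..1} \<and> \<phi> (x i) = v then y i - v else 0)"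
    by (rule sum.cong) auto
  also have "\<dots> = (\<Sum>i | i < n \<and> x i \<in> {0..1} \<and> \<phi> (x i) = v. y i - v)"
    by (subst sum.inter_filter[symmetric]) (auto intro: sum.cong)
  finally show ?thesis by (simp add: v_def)
qed

text \<open>
  This is the min-formula for the first fitted value, that it is the smallest mean of the
  responses over an initial segment. Stated through partial sums, it needs no division and
  no minimum over a data-dependent set, and it allows ties and data points outside the unit
  interval.
\<close>
lemma isotonic_regression_first_value_greater_iff:
  assumes reg: "isotonic_regression n y x \<phi>"
    and k: "k < n" "x k \<in> {0..1}"
    and least: "\<And>i. i < n \<Longrightarrow> x i \<in> {0..1} \<Longrightarrow> x k \<le> x i"
  shows "\<phi> (x k) > a \<longleftrightarrow>
    (\<forall>l<n. x l \<in> {0..1} \<longrightarrow> (\<Sum>i | i < n \<and> x i \<in> {0..1} \<and> x i \<le> x l. y i - a) > 0)"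
    (is "?L \<longleftrightarrow> ?R")
proof
  have mono: "mono_on {0..1} \<phi>"
    using reg by (auto simp: isotonic_regression_def is_arg_min_def isotonic_functions_def)
  show ?R if ?L
  proof safe
    fix l assume l: "l < n" "x l \<in> {0..1}"
    let ?I = "{i. i < n \<and> x i \<in> {0..1} \<and> x i \<le> x l}"
    have "0 < (\<Sum>i\<in>?I. \<phi> (x k) - a)"
      using that l by (intro sum_pos) auto
    also have "\<dots> \<le> (\<Sum>i\<in>?I. \<phi> (x i) - a)"
      using k least by (intro sum_mono diff_right_mono mono_onD[OF mono]) auto
    also have "\<dots> \<le> (\<Sum>i\<in>?I. y i - a)"
      using isotonic_regression_initial_sum[OF reg, of "x l"] by (simp add: sum_subtractf)
    finally show "0 < (\<Sum>i\<in>?I. y i - a)" .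
  qed
  show ?L if R: ?R
  proof (rule ccontr)
    assume le: "\<not> \<phi> (x k) > a"
    let ?B = "{i. i < n \<and> x i \<in> {0..1} \<and> \<phi> (x i) = \<phi> (x k)}"
    have B: "finite ?B" "?B \<noteq> {}" using k by auto
    \<comment> \<open>the first block is an initial segment of the design, ending at its largest point\<close>
    obtain l where l: "l \<in> ?B" "x l = Max (x ` ?B)"
      using Max_in[of "x ` ?B"] B by fastforce
    have max: "x i \<le> x l" if "i \<in> ?B" for i
      unfolding l(2) using B that by (intro Max_ge) auto
    have "{i. i < n \<and> x i \<in> {0..1} \<and> x i \<le> x l} = ?B"
    proof (intro equalityI subsetI)
      fix i assume i: "i \<in> {i. i < n \<and> x i \<in> {0..1} \<and> x i \<le> x l}"
      have "\<phi> (x k) \<le> \<phi> (x i)" using i k least by (intro mono_onD[OF mono]) auto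
      moreover have "\<phi> (x i) \<le> \<phi> (x l)" using i l by (intro mono_onD[OF mono]) auto
      ultimately show "i \<in> ?B" using i l by auto
    qed (use max in auto)
    hence "0 < (\<Sum>i\<in>?B. y i - a)" using R l by fastforce
    also have "\<dots> \<le> (\<Sum>i\<in>?B. y i - \<phi> (x k))" using le by (intro sum_mono) auto
    also have "\<dots> \<le> 0" by (rule isotonic_regression_first_block_sum[OF reg k least])
    finally show False by simp
  qed
qed

lemma isotonic_regression_le_first_response:
  assumes reg: "isotonic_regression n y x \<phi>"
    and k: "k < n" "x k \<in> {0..1}"
    and least: "\<And>i. i < n \<Longrightarrow> i \<noteq> k \<Longrightarrow> x k < x i"
  shows "\<phi> (x k) \<le> y k"
proof -
  have "\<not> x i \<le> x k" if "i < n" "i \<noteq> k" for i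
    using least[OF that] by (simp only: not_le)
  hence "{i. i < n \<and> x i \<in> {0..1} \<and> x i \<le> x k} = {k}"
    using k(1,2) by (auto simp only: order_refl)
  thus ?thesis using isotonic_regression_initial_sum[OF reg, of "x k"] by simp
qed

text \<open>
  Measurability has to hold on the whole sample space, including samples with ties or with data
  outside the unit interval. If the smallest data point lies outside, extensionality fixes the
  value of the fit there.
\<close>
lemma borel_measurable_isotonic_regression_first_value:
  fixes Ys Xs :: "nat \<Rightarrow> 'a \<Rightarrow> real"
  assumes n: "n > 0"
    and [measurable]: "\<And>i. Ys i \<in> borel_measurable M" "\<And>i. Xs i \<in> borel_measurable M"
    and reg: "\<And>\<omega>. \<omega> \<in> space M \<Longrightarrow> isotonic_regression n (\<lambda>i. Ys i \<omega>) (\<lambda>i. Xs i \<omega>) (\<phi> \<omega>)"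
  shows "(\<lambda>\<omega>. \<phi> \<omega> (Min ((\<lambda>i. Xs i \<omega>) ` {..<n}))) \<in> borel_measurable M"
proof (subst borel_measurable_iff_greater, rule allI)
  fix a :: real
  let ?min = "\<lambda>\<omega>. Min ((\<lambda>i. Xs i \<omega>) ` {..<n})"
  let ?P = "\<lambda>\<omega>. \<forall>l\<in>{..<n}. Xs l \<omega> \<in> {0..1} \<longrightarrow>
    (\<Sum>i<n. if Xs i \<omega> \<in> {0..1} \<and> Xs i \<omega> \<le> Xs l \<omega> then Ys i \<omega> - a else 0) > 0"
  have [measurable]: "?min \<in> borel_measurable M" by (rule borel_measurable_Min) auto
  have eq: "\<phi> \<omega> (?min \<omega>) > a \<longleftrightarrow>
      (if ?min \<omega> \<in> {0..1} then ?P \<omega> else (undefined :: real) > a)"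
    if \<omega>: "\<omega> \<in> space M" for \<omega>
  proof (cases "?min \<omega> \<in> {0..1}")
    case True
    obtain k where k: "k < n" "?min \<omega> = Xs k \<omega>"
      using Min_in[of "(\<lambda>i. Xs i \<omega>) ` {..<n}"] n by fastforce
    have least: "Xs k \<omega> \<le> Xs i \<omega>" if "i < n" for i
      unfolding k(2)[symmetric] using that by (intro Min_le) auto
    have sum: "(\<Sum>i | i < n \<and> Xs i \<omega> \<in> {0..1} \<and> Xs i \<omega> \<le> t. Ys i \<omega> - a) =
      (\<Sum>i<n. if Xs i \<omega> \<in> {0..1} \<and> Xs i \<omega> \<le> t then Ys i \<omega> - a else 0)" for t
      by (subst sum.inter_filter[symmetric]) (auto intro: sum.cong)
    show ?thesis
      using isotonic_regression_first_value_greater_iff[OF reg[OF \<omega>] k(1), of a] True least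
      unfolding k(2) sum by auto
  next
    case False
    have "\<phi> \<omega> \<in> extensional {0..1}"
      using reg[OF \<omega>] by (auto simp: isotonic_regression_def is_arg_min_def isotonic_functions_def)
    hence "\<phi> \<omega> (?min \<omega>) = undefined" using False by (rule extensional_arb)
    thus ?thesis using False by (simp only: if_False)
  qed
  have "{\<omega> \<in> space M. if ?min \<omega> \<in> {0..1} then ?P \<omega> else (undefined :: real) > a} \<in> sets M"
    by measurable
  also have "{\<omega> \<in> space M. if ?min \<omega> \<in> {0..1} then ?P \<omega> else (undefined :: real) > a} =
      {\<omega> \<in> space M. a < \<phi> \<omega> (?min \<omega>)}"
    using eq by blast
  finally show "{\<omega> \<in> space M. a < \<phi> \<omega> (?min \<omega>)} \<in> sets M" .
qed

section \<open>Probabilistic ingredients\<close>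

text \<open>
  Every point outside the support lies in a null set from a countable base, and there are only
  countably many of these.
\<close>
lemma AE_in_topological_support:
  fixes \<mu> :: "'b::second_countable_topology measure"
  assumes sets: "sets \<mu> = sets borel"
  shows "AE x in \<mu>. x \<in> topological_support \<mu>"
proof -
  obtain B :: "'b set set" where B: "countable B" "topological_basis B"
    using ex_countable_basis by blast
  let ?N = "\<Union>{U \<in> B. emeasure \<mu> U = 0}"
  have "U \<in> sets \<mu>" if "U \<in> B" for U
    using topological_basis_open[OF B(2) that] by (simp add: sets)
  hence "(\<Union>U\<in>{U \<in> B. emeasure \<mu> U = 0}. U) \<in> null_sets \<mu>"
    by (intro null_sets_UN' countable_subset[OF _ B(1)]) auto
  hence "?N \<in> null_sets \<mu>" by simp
  moreover have "x \<in> ?N" if x: "x \<notin> topological_support \<mu>" for x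
  proof -
    obtain V where V: "open V" "x \<in> V" "emeasure \<mu> V = 0"
      using x by (auto simp: topological_support_def zero_less_iff_neq_zero)
    obtain U where U: "U \<in> B" "x \<in> U" "U \<subseteq> V"
      using topological_basisE[OF B(2) V(1,2)] by blast
    have "emeasure \<mu> U \<le> emeasure \<mu> V" using V(1) U(3) by (intro emeasure_mono) (auto simp: sets)
    thus ?thesis using U V(3) by auto
  qed
  ultimately show ?thesis by (intro AE_I'[of ?N]) auto
qed

text \<open>
  If no level below the mean had positive probability, the centred variable would be
  nonnegative with integral zero.
\<close>
lemma (in prob_space) prob_below_mean_pos:
  fixes f :: "'a \<Rightarrow> real"
  assumes int: "integrable M f" and nd: "\<not> (AE \<omega> in M. f \<omega> = expectation f)"
  shows "\<exists>y < expectation f. prob {\<omega> \<in> space M. f \<omega> \<le> y} > 0"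
proof (rule ccontr)
  assume neg: "\<not> ?thesis"
  have [measurable]: "f \<in> borel_measurable M" using int by auto
  have "AE \<omega> in M. \<not> f \<omega> \<le> expectation f - 1 / Suc k" for k :: nat
  proof -
    have "prob {\<omega> \<in> space M. f \<omega> \<le> expectation f - 1 / Suc k} = 0"
      using neg by (auto simp: zero_less_measure_iff)
    thus ?thesis by (subst (asm) prob_eq_0) auto
  qed
  hence "AE \<omega> in M. \<forall>k::nat. \<not> f \<omega> \<le> expectation f - 1 / Suc k"
    by (simp add: AE_all_countable)
  hence ge: "AE \<omega> in M. 0 \<le> f \<omega> - expectation f"
  proof eventually_elim
    case (elim \<omega>)
    show ?case
    proof (rule ccontr)
      assume "\<not> ?case"
      then obtain k :: nat where "inverse (Suc k) < expectation f - f \<omega>"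
        using reals_Archimedean[of "expectation f - f \<omega>"] by auto
      thus False using elim[rule_format, of k] by (simp add: field_simps)
    qed
  qed
  have "integrable M (\<lambda>\<omega>. f \<omega> - expectation f)" using int by simp
  moreover have "expectation (\<lambda>\<omega>. f \<omega> - expectation f) = 0" using int by (simp add: prob_space)
  ultimately have "AE \<omega> in M. f \<omega> - expectation f = 0"
    using integral_nonneg_eq_0_iff_AE ge by blast
  with nd show False by simp
qed

text \<open>
  A lower bound on the conditional probability of \<open>B\<close> that holds for every fixed value \<open>v\<close> of an
  independent variable \<open>V\<close> survives integration over \<open>V\<close>. This allows treating the competing
  observations as constants.
\<close>
lemma (in prob_space) indep_var_prob_ge_of_sections:
  assumes ind: "indep_var N Z L V" and S: "S \<in> sets (N \<Otimes>\<^sub>M L)" and B: "B \<in> sets N"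
    and sect: "\<And>v. v \<in> space L \<Longrightarrow>
      c * prob {\<omega> \<in> space M. (Z \<omega>, v) \<in> S} \<le> prob {\<omega> \<in> space M. Z \<omega> \<in> B \<and> (Z \<omega>, v) \<in> S}"
    and c: "c \<ge> 0"
  shows "c * prob {\<omega> \<in> space M. (Z \<omega>, V \<omega>) \<in> S} \<le>
    prob {\<omega> \<in> space M. Z \<omega> \<in> B \<and> (Z \<omega>, V \<omega>) \<in> S}"
proof -
  have [measurable]: "Z \<in> M \<rightarrow>\<^sub>M N" "V \<in> M \<rightarrow>\<^sub>M L" using ind by (auto simp: indep_var_def indep_vars_def split: bool.splits)
  note [measurable] = S B
  interpret Z: prob_space "distr M N Z" by (rule prob_space_distr) simp
  interpret V: prob_space "distr M L V" by (rule prob_space_distr) simp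
  interpret ZV: pair_sigma_finite "distr M N Z" "distr M L V" ..
  have eq: "emeasure M {\<omega> \<in> space M. (Z \<omega>, V \<omega>) \<in> T} =
      (\<integral>\<^sup>+v. emeasure M {\<omega> \<in> space M. (Z \<omega>, v) \<in> T} \<partial>distr M L V)"
    if [measurable]: "T \<in> sets (N \<Otimes>\<^sub>M L)" for T
  proof -
    have "emeasure M {\<omega> \<in> space M. (Z \<omega>, V \<omega>) \<in> T} =
        emeasure (distr M (N \<Otimes>\<^sub>M L) (\<lambda>\<omega>. (Z \<omega>, V \<omega>))) T"
      by (subst emeasure_distr) (auto intro!: arg_cong[where f="emeasure M"])
    also have "\<dots> = emeasure (distr M N Z \<Otimes>\<^sub>M distr M L V) T"
      using ind by (simp add: indep_var_distribution_eq)
    also have "\<dots> = (\<integral>\<^sup>+v. emeasure (distr M N Z) ((\<lambda>z. (z, v)) -` T) \<partial>distr M L V)"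
      by (rule ZV.emeasure_pair_measure_alt2) (simp cong: sets_pair_measure_cong)
    also have "\<dots> = (\<integral>\<^sup>+v. emeasure M {\<omega> \<in> space M. (Z \<omega>, v) \<in> T} \<partial>distr M L V)"
    proof (intro nn_integral_cong)
      fix v
      have "(\<lambda>z. (z, v)) -` T \<in> sets N" by (rule sets_Pair2[OF that])
      thus "emeasure (distr M N Z) ((\<lambda>z. (z, v)) -` T) = emeasure M {\<omega> \<in> space M. (Z \<omega>, v) \<in> T}"
        by (subst emeasure_distr) (auto intro!: arg_cong[where f="emeasure M"])
    qed
    finally show ?thesis .
  qed
  have T: "S \<inter> B \<times> space L \<in> sets (N \<Otimes>\<^sub>M L)" by measurable
  have meas: "(\<lambda>v. emeasure M {\<omega> \<in> space M. (Z \<omega>, v) \<in> S}) \<in> borel_measurable (distr M L V)"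
  proof -
    have "(\<lambda>v. emeasure (distr M N Z) ((\<lambda>z. (z, v)) -` S)) \<in> borel_measurable (distr M L V)"
      by (rule ZV.measurable_emeasure_Pair2) (simp cong: sets_pair_measure_cong)
    moreover have "emeasure (distr M N Z) ((\<lambda>z. (z, v)) -` S) =
        emeasure M {\<omega> \<in> space M. (Z \<omega>, v) \<in> S}" for v
      by (subst emeasure_distr) (auto intro!: arg_cong[where f="emeasure M"] sets_Pair2[OF S])
    ultimately show ?thesis by simp
  qed
  have "ennreal c * emeasure M {\<omega> \<in> space M. (Z \<omega>, V \<omega>) \<in> S} =
      (\<integral>\<^sup>+v. ennreal c * emeasure M {\<omega> \<in> space M. (Z \<omega>, v) \<in> S} \<partial>distr M L V)"
    by (simp add: eq[OF S] nn_integral_cmult[OF meas])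
  also have "\<dots> \<le> (\<integral>\<^sup>+v. emeasure M {\<omega> \<in> space M. (Z \<omega>, v) \<in> S \<inter> B \<times> space L} \<partial>distr M L V)"
  proof (rule nn_integral_mono)
    fix v assume "v \<in> space (distr M L V)"
    hence v: "v \<in> space L" by simp
    hence "{\<omega> \<in> space M. (Z \<omega>, v) \<in> S \<inter> B \<times> space L} =
        {\<omega> \<in> space M. Z \<omega> \<in> B \<and> (Z \<omega>, v) \<in> S}" by auto
    thus "ennreal c * emeasure M {\<omega> \<in> space M. (Z \<omega>, v) \<in> S} \<le>
        emeasure M {\<omega> \<in> space M. (Z \<omega>, v) \<in> S \<inter> B \<times> space L}"
      using sect[OF v] c by (simp add: emeasure_eq_measure ennreal_mult[symmetric] ennreal_leI)
  qed
  also have "\<dots> = emeasure M {\<omega> \<in> space M. (Z \<omega>, V \<omega>) \<in> S \<inter> B \<times> space L}"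
    by (rule eq[OF T, symmetric])
  also have "{\<omega> \<in> space M. (Z \<omega>, V \<omega>) \<in> S \<inter> B \<times> space L} =
      {\<omega> \<in> space M. Z \<omega> \<in> B \<and> (Z \<omega>, V \<omega>) \<in> S}"
    using measurable_space[of V M L] by auto
  finally show ?thesis
    using c by (simp add: emeasure_eq_measure ennreal_mult[symmetric])
qed

lemma (in prob_space) regular_cond_distr_prob_ge:
  assumes K: "regular_cond_distr M Y X K" and X: "X \<in> borel_measurable M"
    and A: "A \<in> sets borel" and B: "B \<in> sets borel" and c: "c \<ge> 0"
    and ge: "\<And>x. x \<in> A \<Longrightarrow> c \<le> measure (K x) B"
  shows "c * prob {\<omega> \<in> space M. X \<omega> \<in> A} \<le> prob {\<omega> \<in> space M. X \<omega> \<in> A \<and> Y \<omega> \<in> B}"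
proof -
  have "ennreal c * emeasure M {\<omega> \<in> space M. X \<omega> \<in> A} = (\<integral>\<^sup>+x. ennreal c * indicator A x \<partial>distr M borel X)"
    using X A by (subst nn_integral_cmult_indicator)
      (auto simp: emeasure_distr vimage_def Int_def conj_commute)
  also have "\<dots> \<le> (\<integral>\<^sup>+x\<in>A. emeasure (K x) B \<partial>distr M borel X)"
  proof (rule nn_integral_mono)
    fix x
    have "K x \<in> space (prob_algebra borel)"
      using K by (auto simp: regular_cond_distr_def measurable_def)
    then interpret Kx: prob_space "K x" by (simp add: space_prob_algebra)
    show "ennreal c * indicator A x \<le> emeasure (K x) B * indicator A x"
      using ge[of x] by (auto simp: indicator_def Kx.emeasure_eq_measure ennreal_leI)
  qed
  also have "\<dots> = emeasure M {\<omega> \<in> space M. X \<omega> \<in> A \<and> Y \<omega> \<in> B}"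
    using K A B by (simp add: regular_cond_distr_def)
  finally show ?thesis
    using c by (simp add: emeasure_eq_measure ennreal_mult[symmetric])
qed

section \<open>Inconsistency at the boundary\<close>

theorem theoremA1:
  fixes M :: "'a measure"
    and Y X eps :: "'a \<Rightarrow> real"
    and Ys Xs :: "nat \<Rightarrow> 'a \<Rightarrow> real"
    and m :: "real \<Rightarrow> real"
    and K :: "real \<Rightarrow> real measure"
    and mhat :: "nat \<Rightarrow> 'a \<Rightarrow> real \<Rightarrow> real"
  assumes "prob_space M"
    and Y_rv: "Y \<in> borel_measurable M"
    and X_rv: "X \<in> borel_measurable M"
    and indep: "prob_space.indep_vars M (\<lambda>_. borel \<Otimes>\<^sub>M borel) (\<lambda>i \<omega>. (Ys i \<omega>, Xs i \<omega>)) UNIV"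
    and ident: "\<And>i. distr M (borel \<Otimes>\<^sub>M borel) (\<lambda>\<omega>. (Ys i \<omega>, Xs i \<omega>)) =
                     distr M (borel \<Otimes>\<^sub>M borel) (\<lambda>\<omega>. (Y \<omega>, X \<omega>))"
    and distinct: "AE \<omega> in M. inj (\<lambda>i. Xs i \<omega>)"
    and support: "topological_support (distr M borel X) = {0..1}"
    and model: "\<And>\<omega>. \<omega> \<in> space M \<Longrightarrow> Y \<omega> = m (X \<omega>) + eps \<omega>"
    and eps_int: "integrable M eps"
    and eps_mean: "AE \<omega> in M. real_cond_exp M (vimage_algebra (space M) X borel) eps \<omega> = 0"
    and K: "regular_cond_distr M Y X K"
    and K_cont: "\<And>y. continuous_on {0..1} (\<lambda>x. measure (K x) {..y})"
    and K_int: "\<And>x. x \<in> {0..1} \<Longrightarrow> integrable (K x) (\<lambda>y. y)"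
    and m_eq: "\<And>x. x \<in> {0..1} \<Longrightarrow> m x = (\<integral>y. y \<partial>K x)"
    and m_mono: "mono_on {0..1} m"
    and nondegenerate: "\<nexists>c. distr (K 0) borel (\<lambda>y. y - m 0) = return borel c"
    and mhat: "\<And>n \<omega>. n > 0 \<Longrightarrow> \<omega> \<in> space M \<Longrightarrow>
                 isotonic_regression n (\<lambda>i. Ys i \<omega>) (\<lambda>i. Xs i \<omega>) (mhat n \<omega>)"
  shows "\<exists>\<epsilon>>0. liminf (\<lambda>n. ereal (measure M
           {\<omega> \<in> space M. \<bar>mhat n \<omega> (Min ((\<lambda>i. Xs i \<omega>) ` {..<n})) - m 0\<bar> > \<epsilon>})) > 0"
proof -
  interpret prob_space M by fact
  note [measurable] = Y_rv X_rv
  let ?N = "borel \<Otimes>\<^sub>M borel :: (real \<times> real) measure"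
  let ?Z = "\<lambda>i \<omega>. (Ys i \<omega>, Xs i \<omega>)"
  have Zm[measurable]: "?Z i \<in> M \<rightarrow>\<^sub>M ?N" for i
    using indep by (simp add: indep_vars_def)
  have [measurable]: "Ys i \<in> borel_measurable M" "Xs i \<in> borel_measurable M" for i
    using measurable_compose[OF Zm measurable_fst] measurable_compose[OF Zm measurable_snd] by auto
  have same: "prob {\<omega> \<in> space M. ?Z i \<omega> \<in> T} = prob {\<omega> \<in> space M. (Y \<omega>, X \<omega>) \<in> T}"
    if "T \<in> sets ?N" for i T
  proof -
    have "measure (distr M ?N (?Z i)) T = measure (distr M ?N (\<lambda>\<omega>. (Y \<omega>, X \<omega>))) T"
      by (simp add: ident)
    thus ?thesis using that
      by (simp add: measure_distr vimage_def Int_def conj_commute)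
  qed

  have K0: "K 0 \<in> space (prob_algebra borel)"
    using K by (auto simp: regular_cond_distr_def measurable_def)
  interpret K0: prob_space "K 0" using K0 by (simp add: space_prob_algebra)
  have K0_sets[measurable_cong]: "sets (K 0) = sets borel" using K0 by (simp add: space_prob_algebra)
  have K0_space: "space (K 0) = UNIV" using sets_eq_imp_space_eq[OF K0_sets] by simp
  have m0: "K0.expectation (\<lambda>y. y) = m 0" by (simp add: m_eq)
  have "\<not> (AE y in K 0. y = m 0)"
  proof
    assume ae: "AE y in K 0. y = m 0"
    have "distr (K 0) borel (\<lambda>y. y - m 0) = distr (K 0) borel (\<lambda>y. 0)"
      using ae by (intro distr_cong_AE) auto
    also have "\<dots> = return borel 0" by (rule K0.distr_const) simp
    finally show False using nondegenerate by blast
  qed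
  then obtain y0 where y0: "y0 < m 0" "K0.prob {..y0} > 0"
    using K0.prob_below_mean_pos[of "\<lambda>y. y"] K_int[of 0] m0 by (auto simp: K0_space atMost_def)

  \<comment> \<open>strictly below the mass at \<open>0\<close>, to leave room for the continuity argument\<close>
  define c where "c = K0.prob {..y0} / 2"
  have c: "c > 0" "c < measure (K 0) {..y0}" using y0(2) by (auto simp: c_def)
  obtain \<delta> where \<delta>: "0 < \<delta>" "\<delta> \<le> 1" "\<And>x. x \<in> {0..\<delta>} \<Longrightarrow> c \<le> measure (K x) {..y0}"
  proof -
    have "\<forall>\<^sub>F x in at 0 within {0..1}. c < measure (K x) {..y0}"
      using K_cont[of y0] c(2) by (intro order_tendstoD(1)) (auto simp: continuous_on_def)
    then obtain d where d: "d > 0" "\<And>x. x \<in> {0..1} \<Longrightarrow> x \<noteq> 0 \<Longrightarrow> dist x 0 < d \<Longrightarrow> c < measure (K x) {..y0}"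
      unfolding eventually_at by blast
    have "c \<le> measure (K x) {..y0}" if "x \<in> {0..min (d / 2) 1}" for x
      using d(2)[of x] c that d(1) by (cases "x = 0") (auto simp: less_imp_le)
    thus ?thesis using d(1) by (intro that[of "min (d / 2) 1"]) auto
  qed

  define p where "p = prob {\<omega> \<in> space M. X \<omega> \<in> {0..\<delta>}}"
  have X_supp: "AE \<omega> in M. X \<omega> \<in> {0..1}"
    using AE_in_topological_support[of "distr M borel X"] by (simp add: support AE_distr_iff)
  have Xs_supp: "AE \<omega> in M. \<forall>i. Xs i \<omega> \<in> {0..1}"
  proof (subst AE_all_countable, rule allI)
    fix i
    have "prob {\<omega> \<in> space M. Xs i \<omega> \<in> {0..1}} = prob {\<omega> \<in> space M. X \<omega> \<in> {0..1}}"
      using same[of "UNIV \<times> {0..1}" i] by simp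
    also have "\<dots> = 1" using X_supp by (subst prob_eq_1) (auto elim: eventually_mono)
    finally show "AE \<omega> in M. Xs i \<omega> \<in> {0..1}" by (subst (asm) prob_eq_1) auto
  qed
  have p: "p > 0"
  proof -
    have "0 \<in> topological_support (distr M borel X)" by (simp add: support)
    hence "emeasure (distr M borel X) {-\<delta><..<\<delta>} > 0"
      using \<delta>(1) unfolding topological_support_def by auto
    hence "prob {\<omega> \<in> space M. X \<omega> \<in> {-\<delta><..<\<delta>}} > 0"
      by (simp add: emeasure_distr emeasure_eq_measure vimage_def Int_def conj_commute)
    also have "\<dots> \<le> p" unfolding p_def
      using X_supp by (intro finite_measure_mono_AE) (auto elim!: eventually_mono)
    finally show ?thesis .
  qed

  \<comment> \<open>half the gap, because the deviation in the claim is strict while \<open>mhat\<close> may equal \<open>y0\<close>\<close>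
  define \<epsilon> where "\<epsilon> = (m 0 - y0) / 2"
  have \<epsilon>: "\<epsilon> > 0" using y0 by (simp add: \<epsilon>_def)
  let ?E = "\<lambda>n. {\<omega> \<in> space M. \<bar>mhat n \<omega> (Min ((\<lambda>i. Xs i \<omega>) ` {..<n})) - m 0\<bar> > \<epsilon>}"
  have bound: "c * p \<le> prob (?E n)" if n: "n > 0" for n
  proof -
    let ?J = "\<lambda>i. {..<n} - {i}"
    \<comment> \<open>the strict inequality makes these events disjoint, so that their probabilities add up\<close>
    define A where "A i = {\<omega> \<in> space M. Xs i \<omega> \<in> {0..\<delta>} \<and> (\<forall>j\<in>?J i. Xs i \<omega> < Xs j \<omega>)}" for i
    define F where "F i = {\<omega> \<in> space M. Ys i \<omega> \<le> y0 \<and> \<omega> \<in> A i}" for i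
    have A[measurable]: "A i \<in> sets M" for i unfolding A_def by measurable
    have F[measurable]: "F i \<in> sets M" for i unfolding F_def by measurable
    have [measurable]: "(\<lambda>\<omega>. mhat n \<omega> (Min ((\<lambda>i. Xs i \<omega>) ` {..<n}))) \<in> borel_measurable M"
      by (rule borel_measurable_isotonic_regression_first_value[OF n]) (auto intro: mhat n)
    have E[measurable]: "?E n \<in> sets M" by measurable

    have AF: "c * prob (A i) \<le> prob (F i)" if i: "i < n" for i
    proof -
      let ?L1 = "PiM {i} (\<lambda>_. ?N)"
      let ?V1 = "\<lambda>\<omega>. restrict (\<lambda>j. ?Z j \<omega>) {i}"
      let ?B = "{g \<in> space ?L1. fst (g i) \<le> y0}"
      let ?L = "PiM (?J i) (\<lambda>_. ?N)"
      let ?V = "\<lambda>\<omega>. restrict (\<lambda>j. ?Z j \<omega>) (?J i)"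
      let ?S = "{zv \<in> space (?L1 \<Otimes>\<^sub>M ?L). snd (fst zv i) \<in> {0..\<delta>} \<and>
        (\<forall>j\<in>?J i. snd (fst zv i) < snd (snd zv j))}"
      \<comment> \<open>observation \<open>i\<close> enters as a family indexed by \<open>{i}\<close>, since \<open>indep_var\<close> relates
        variables of the same type\<close>
      have ind: "indep_var ?L1 ?V1 ?L ?V"
        by (rule indep_var_restrict[OF indep]) auto
      have S: "?S \<in> sets (?L1 \<Otimes>\<^sub>M ?L)" by measurable
      have B: "?B \<in> sets ?L1" by measurable
      have "c * prob {\<omega> \<in> space M. (?V1 \<omega>, ?V \<omega>) \<in> ?S} \<le>
          prob {\<omega> \<in> space M. ?V1 \<omega> \<in> ?B \<and> (?V1 \<omega>, ?V \<omega>) \<in> ?S}"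
      proof (rule indep_var_prob_ge_of_sections[OF ind S B])
        fix v assume v: "v \<in> space ?L"
        let ?A = "{x \<in> {0..\<delta>}. \<forall>j\<in>?J i. x < snd (v j)}"
        have [measurable]: "?A \<in> sets borel" by measurable
        have eq1: "{\<omega> \<in> space M. (?V1 \<omega>, v) \<in> ?S} = {\<omega> \<in> space M. ?Z i \<omega> \<in> UNIV \<times> ?A}"
          using v by (auto simp: space_pair_measure space_PiM)
        have eq2: "{\<omega> \<in> space M. ?V1 \<omega> \<in> ?B \<and> (?V1 \<omega>, v) \<in> ?S} =
            {\<omega> \<in> space M. ?Z i \<omega> \<in> {..y0} \<times> ?A}"
          using v by (auto simp: space_pair_measure space_PiM)
        have s1: "prob {\<omega> \<in> space M. ?Z i \<omega> \<in> UNIV \<times> ?A} = prob {\<omega> \<in> space M. X \<omega> \<in> ?A}"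
          by (subst same) (auto simp: mem_Times_iff)
        have s2: "prob {\<omega> \<in> space M. ?Z i \<omega> \<in> {..y0} \<times> ?A} =
            prob {\<omega> \<in> space M. X \<omega> \<in> ?A \<and> Y \<omega> \<in> {..y0}}"
          by (subst same) (auto simp: mem_Times_iff intro!: arg_cong[where f=prob])
        show "c * prob {\<omega> \<in> space M. (?V1 \<omega>, v) \<in> ?S} \<le>
            prob {\<omega> \<in> space M. ?V1 \<omega> \<in> ?B \<and> (?V1 \<omega>, v) \<in> ?S}"
          unfolding eq1 eq2 s1 s2 using c \<delta>(3)
          by (intro regular_cond_distr_prob_ge[OF K X_rv]) auto
      qed (use c in auto)
      moreover have "{\<omega> \<in> space M. (?V1 \<omega>, ?V \<omega>) \<in> ?S} = A i"
        by (auto simp: A_def space_pair_measure space_PiM)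
      moreover have "{\<omega> \<in> space M. ?V1 \<omega> \<in> ?B \<and> (?V1 \<omega>, ?V \<omega>) \<in> ?S} = F i"
        by (auto simp: A_def F_def space_pair_measure space_PiM)
      ultimately show ?thesis by simp
    qed

    have FE: "F i \<subseteq> ?E n" if i: "i < n" for i
    proof
      fix \<omega> assume \<omega>: "\<omega> \<in> F i"
      have least: "Xs i \<omega> < Xs j \<omega>" if "j < n" "j \<noteq> i" for j
        using \<omega> that by (auto simp: F_def A_def)
      have "Min ((\<lambda>i. Xs i \<omega>) ` {..<n}) = Xs i \<omega>"
      proof (intro Min_eqI)
        fix t assume "t \<in> (\<lambda>i. Xs i \<omega>) ` {..<n}"
        then obtain j where "j < n" "t = Xs j \<omega>" by auto
        thus "Xs i \<omega> \<le> t" using least[of j] by (cases "j = i") auto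
      qed (use i in auto)
      moreover have "mhat n \<omega> (Xs i \<omega>) \<le> Ys i \<omega>"
        using \<omega> n \<delta>(2) i least
        by (intro isotonic_regression_le_first_response[OF mhat]) (auto simp: F_def A_def)
      ultimately show "\<omega> \<in> ?E n" using \<omega> y0(1) by (auto simp: F_def \<epsilon>_def abs_if field_simps)
    qed
    have disj: "disjoint_family_on F {..<n}"
    proof (unfold disjoint_family_on_def, intro ballI impI)
      fix i j assume ij: "i \<in> {..<n}" "j \<in> {..<n}" "i \<noteq> j"
      have False if "\<omega> \<in> F i" "\<omega> \<in> F j" for \<omega>
      proof -
        have "Xs i \<omega> < Xs j \<omega>" using that(1) ij by (simp add: F_def A_def)
        moreover have "Xs j \<omega> < Xs i \<omega>" using that(2) ij by (simp add: F_def A_def)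
        ultimately show False by simp
      qed
      thus "F i \<inter> F j = {}" by blast
    qed

    have "p = prob {\<omega> \<in> space M. Xs 0 \<omega> \<in> {0..\<delta>}}"
      using same[of "UNIV \<times> {0..\<delta>}" 0] by (simp add: p_def)
    also have "\<dots> \<le> prob (\<Union>i<n. A i)"
    proof (rule finite_measure_mono_AE)
      show "AE \<omega> in M. \<omega> \<in> {\<omega> \<in> space M. Xs 0 \<omega> \<in> {0..\<delta>}} \<longrightarrow> \<omega> \<in> (\<Union>i<n. A i)"
        using distinct Xs_supp
      proof eventually_elim
        case (elim \<omega>)
        obtain k where k: "k < n" "Xs k \<omega> = Min ((\<lambda>i. Xs i \<omega>) ` {..<n})"
          using Min_in[of "(\<lambda>i. Xs i \<omega>) ` {..<n}"] n by fastforce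
        have le: "Xs k \<omega> \<le> Xs j \<omega>" if "j < n" for j
          unfolding k(2) using that by (intro Min_le) auto
        have "Xs k \<omega> < Xs j \<omega>" if "j < n" "j \<noteq> k" for j
          using le[OF that(1)] injD[OF elim(1), of k j] that(2) by (auto simp: less_le)
        thus ?case using k(1) le[OF n] elim(2) by (auto simp: A_def intro!: bexI[of _ k])
      qed
    qed auto
    also have "\<dots> \<le> (\<Sum>i<n. prob (A i))"
      by (rule finite_measure_subadditive_finite) auto
    finally have "c * p \<le> c * (\<Sum>i<n. prob (A i))" using c by simp
    also have "\<dots> \<le> (\<Sum>i<n. prob (F i))"
      unfolding sum_distrib_left using AF by (intro sum_mono) auto
    also have "\<dots> = prob (\<Union>i<n. F i)"
      using disj by (intro finite_measure_finite_Union[symmetric]) auto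
    also have "\<dots> \<le> prob (?E n)"
      using FE by (intro finite_measure_mono) auto
    finally show ?thesis .
  qed

  have "0 < ereal (c * p)" using c p by simp
  also have "\<dots> \<le> liminf (\<lambda>n. ereal (prob (?E n)))"
    using bound by (intro Liminf_bounded) (auto intro!: eventually_mono[OF eventually_gt_at_top[of 0]])
  finally show ?thesis using \<epsilon> by blast
qed

end
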